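(* Let $\mathcal{Z}$ be the ideal of subsets of $\omega$ with asymptotic density zero. There exists an infinite real matrix $B=(b_{n,k}:n,k\in\omega)\in(\ell_\infty,\ell_\infty)$ such that $$\mathrm{core}_{B\bm{x}}(\mathcal{Z})=\mathrm{core}_{\bm{x}}(\mathcal{Z})\quad\text{for all sequences }\bm{x}\in\ell_\infty,$$ but it is not true that $\mathcal{Z}\text{-}\limsup_{n}\sum_{k\in E}|b_{n,k}|=1$ for all $E\subseteq\omega$ with $E\notin\mathcal{Z}$.
   Context: $\omega$ is the set of natural numbers (including $0$). $\mathcal{Z}$ is the family of all $S\subseteq\omega$ such that $|S\cap[0,n]|=o(n)$ as $n\to\infty$. Write $\mathcal{Z}^\star:=\{S\subseteq\omega:\omega\setminus S\in\mathcal{Z}\}$. $\ell_\infty$ is the space of bounded real sequences indexed by $\omega$. For a real sequence $\bm{x}=(x_n:n\in\omega)$, $\mathrm{core}_{\bm{x}}(\mathcal{Z}):=\bigcap_{S\in\mathcal{Z}^\star}\overline{\mathrm{co}}\{x_n:n\in S\}$, where $\overline{\mathrm{co}}$ denotes the closed convex hull. A point $\eta\in\mathbf{R}$ is a $\mathcal{Z}$-cluster point of $\bm{x}$ if $\{n\in\omega:x_n\in U\}\notin\mathcal{Z}$ for all neighborhoods $U$ of $\eta$. For bounded real $\bm{x}$ the set of $\mathcal{Z}$-cluster points is nonempty and compact, and $\mathcal{Z}\text{-}\limsup\bm{x}$ denotes its maximum. For an infinite real matrix $B=(b_{n,k}:n,k\in\omega)$ and a real sequence $\bm{x}$, $B\bm{x}$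 is the sequence whose $n$-th term is $\sum_{k\in\omega}b_{n,k}x_k$, defined if every such series converges to a real number. $B\in(\ell_\infty,\ell_\infty)$ means that $B\bm{x}$ is defined and bounded for all $\bm{x}\in\ell_\infty$. *)

theory Defs
  imports "HOL-Analysis.Analysis" "HOL-Library.Landau_Symbols"
begin

definition density_zero :: "nat set set" where
  "density_zero = {S. (\<lambda>n. real (card (S \<inter> {0..n}))) \<in> o(\<lambda>n. real n)}"

definition density_zero_star :: "nat set set" where
  "density_zero_star = {S. - S \<in> density_zero}"

definition ell_infty :: "(nat \<Rightarrow> real) set" where
  "ell_infty = {x. bounded (range x)}"

definition Z_core :: "(nat \<Rightarrow> real) \<Rightarrow> real set" where
  "Z_core x = (\<Inter>S\<in>density_zero_star. closure (convex hull (x ` S)))"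

definition Z_cluster_point :: "(nat \<Rightarrow> real) \<Rightarrow> real \<Rightarrow> bool" where
  "Z_cluster_point x \<eta> \<longleftrightarrow> (\<forall>U. \<eta> \<in> interior U \<longrightarrow> {n. x n \<in> U} \<notin> density_zero)"

text \<open>The value is meaningful for bounded sequences, whose set of cluster points is nonempty and
  compact and hence has a maximum.\<close>

definition Z_limsup :: "(nat \<Rightarrow> real) \<Rightarrow> real" where
  "Z_limsup x = (GREATEST \<eta>. Z_cluster_point x \<eta>)"

text \<open>Definedness of the transform is a separate predicate, since \<^const>\<open>suminf\<close> is total.\<close>

definition transform_defined :: "(nat \<Rightarrow> nat \<Rightarrow> real) \<Rightarrow> (nat \<Rightarrow> real) \<Rightarrow> bool" where
  "transform_defined B x \<longleftrightarrow> (\<forall>n. summable (\<lambda>k. B n k * x k))"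

definition transform :: "(nat \<Rightarrow> nat \<Rightarrow> real) \<Rightarrow> (nat \<Rightarrow> real) \<Rightarrow> nat \<Rightarrow> real" where
  "transform B x n = (\<Sum>k. B n k * x k)"

definition ell_infty_matrices :: "(nat \<Rightarrow> nat \<Rightarrow> real) set" where
  "ell_infty_matrices =
     {B. \<forall>x\<in>ell_infty. transform_defined B x \<and> transform B x \<in> ell_infty}"

end

theory Submission
  imports Defs "HOL-Real_Asymp.Real_Asymp"
begin

text \<open>
  The idea is to perturb the identity matrix by rows of normalised Hadamard matrices: in the rows
  $2^j \le n < 2^{j+1}$ put $H/M$, where $H$ is the Hadamard matrix of order $M = 2^{j+1}$. By
  Parseval, $\sum_{n < M} ((H\bm{x})_n/M)^2 = \frac1M \sum_{k < M} x_k^2 \le \|\bm{x}\|_\infty^2$,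
  so in each dyadic block only boundedly many entries of the perturbation exceed a given
  $\varepsilon$. Up to $n$ these are $O(\log n)$ indices, hence $B\bm{x} - \bm{x}$ is
  $\mathcal{Z}$-null and the core is unchanged. But every row of $H/M$ has $\ell_1$-norm $1$, so
  the $\ell_1$-norms of the rows of $B$ tend to $2$, and $E = \omega$ violates the condition.
\<close>

section \<open>The density ideal\<close>

lemma density_zero_subset:
  assumes "S \<in> density_zero" "T \<subseteq> S"
  shows "T \<in> density_zero"
proof -
  have "real (card (T \<inter> {0..n})) \<le> real (card (S \<inter> {0..n}))" for n
    using assms(2) by (intro of_nat_mono card_mono) auto
  then have "(\<lambda>n. real (card (T \<inter> {0..n}))) \<in> O(\<lambda>n. real (card (S \<inter> {0..n})))"
    by (intro landau_o.big_mono always_eventually) auto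
  then show ?thesis
    using assms(1) unfolding density_zero_def by (auto intro: landau_o.big_small_trans)
qed

lemma density_zero_Un:
  assumes "S \<in> density_zero" "T \<in> density_zero"
  shows "S \<union> T \<in> density_zero"
proof -
  have "real (card ((S \<union> T) \<inter> {0..n})) \<le> real (card (S \<inter> {0..n})) + real (card (T \<inter> {0..n}))" for n
    using card_Un_le[of "S \<inter> {0..n}" "T \<inter> {0..n}"] by (simp add: Int_Un_distrib2)
  then have "(\<lambda>n. real (card ((S \<union> T) \<inter> {0..n})))
      \<in> O(\<lambda>n. real (card (S \<inter> {0..n})) + real (card (T \<inter> {0..n})))"
    by (intro landau_o.big_mono always_eventually) auto
  moreover have "(\<lambda>n. real (card (S \<inter> {0..n})) + real (card (T \<inter> {0..n}))) \<in> o(\<lambda>n. real n)"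
    using assms unfolding density_zero_def by (auto intro: sum_in_smallo)
  ultimately show ?thesis
    unfolding density_zero_def by (auto intro: landau_o.big_small_trans)
qed

lemma finite_in_density_zero:
  assumes "finite S"
  shows "S \<in> density_zero"
proof -
  have "(\<lambda>n. real (card (S \<inter> {0..n}))) \<in> O(\<lambda>n. real (card S))"
    using assms by (intro landau_o.big_mono always_eventually) (auto intro!: card_mono)
  moreover have "(\<lambda>n. real (card S)) \<in> o(\<lambda>n. real n)"
    by real_asymp
  ultimately show ?thesis
    unfolding density_zero_def by (auto intro: landau_o.big_small_trans)
qed

text \<open>If the count \<open>n + 1\<close> were o(n), then n would be o(n) and so eventually
  zero. This is what makes \<open>UNIV\<close> an admissible choice of E.\<close>

lemma UNIV_notin_density_zero: "UNIV \<notin> density_zero"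
proof
  assume "UNIV \<in> density_zero"
  then have "(\<lambda>n. real (Suc n)) \<in> o(\<lambda>n. real n)"
    by (simp add: density_zero_def)
  moreover have "(\<lambda>n. real n) \<in> O(\<lambda>n. real (Suc n))"
    by real_asymp
  ultimately have "(\<lambda>n. real n) \<in> o(\<lambda>n. real n)"
    by (rule landau_o.big_small_trans[rotated])
  then have "eventually (\<lambda>n. real n = 0) sequentially"
    by (simp add: landau_o.small_refl_iff)
  then obtain N where "\<forall>n\<ge>N. real n = 0"
    by (auto simp: eventually_sequentially)
  then show False
    by (auto dest: spec[of _ "Suc N"])
qed

lemma density_zero_star_Int:
  "S \<in> density_zero_star \<Longrightarrow> T \<in> density_zero_star \<Longrightarrow> S \<inter> T \<in> density_zero_star"
  by (simp add: density_zero_star_def density_zero_Un)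

section \<open>Cluster points, limit superior and core\<close>

lemma Z_cluster_point_LIMSEQ_iff:
  assumes "r \<longlonglongrightarrow> l"
  shows "Z_cluster_point r \<eta> \<longleftrightarrow> \<eta> = l"
proof
  assume cl: "Z_cluster_point r \<eta>"
  show "\<eta> = l"
  proof (rule ccontr)
    assume "\<eta> \<noteq> l"
    \<comment> \<open>Half the distance makes the balls around \<eta> and \<open>l\<close> disjoint,
      so only finitely many terms can lie in the ball around \<eta>.\<close>
    define d where "d = dist \<eta> l / 2"
    have "d > 0" using \<open>\<eta> \<noteq> l\<close> by (simp add: d_def)
    then have "eventually (\<lambda>n. dist (r n) l < d) sequentially"
      using assms by (simp add: tendsto_iff)
    then obtain N where N: "\<And>n. n \<ge> N \<Longrightarrow> dist (r n) l < d"
      by (auto simp: eventually_sequentially)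
    have "{n. r n \<in> ball \<eta> d} \<subseteq> {..<N}"
    proof
      fix n assume "n \<in> {n. r n \<in> ball \<eta> d}"
      then have "dist \<eta> (r n) < d" by simp
      moreover have "dist \<eta> l \<le> dist \<eta> (r n) + dist (r n) l" by (rule dist_triangle)
      ultimately have "\<not> dist (r n) l < d" unfolding d_def by linarith
      then show "n \<in> {..<N}" using N by (meson lessThan_iff not_le)
    qed
    then have "{n. r n \<in> ball \<eta> d} \<in> density_zero"
      by (intro finite_in_density_zero) (rule finite_subset, auto)
    moreover have "\<eta> \<in> interior (ball \<eta> d)"
      using \<open>d > 0\<close> by simp
    ultimately show False
      using cl unfolding Z_cluster_point_def by blast
  qed
next
  assume "\<eta> = l"
  show "Z_cluster_point r \<eta>"
    unfolding Z_cluster_point_def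
  proof (intro allI impI notI)
    fix U assume "\<eta> \<in> interior U" and null: "{n. r n \<in> U} \<in> density_zero"
    \<comment> \<open>All but finitely many indices land in \<open>U\<close>; were these null, the
      whole of \<open>UNIV\<close> would be null.\<close>
    then have "eventually (\<lambda>n. r n \<in> interior U) sequentially"
      using assms \<open>\<eta> = l\<close> by (auto dest: topological_tendstoD)
    then have "finite {n. r n \<notin> interior U}"
      by (simp add: eventually_cofinite flip: cofinite_eq_sequentially)
    then have "{n. r n \<notin> interior U} \<in> density_zero"
      by (rule finite_in_density_zero)
    then have "{n. r n \<in> U} \<union> {n. r n \<notin> interior U} \<in> density_zero"
      using null by (intro density_zero_Un)
    moreover have "{n. r n \<in> U} \<union> {n. r n \<notin> interior U} = UNIV"
      using interior_subset by blast
    ultimately show False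
      using UNIV_notin_density_zero by simp
  qed
qed

text \<open>The limit is the only cluster point, so the \<open>GREATEST\<close> exists. The row
  norms can thus be treated by ordinary convergence.\<close>

lemma Z_limsup_LIMSEQ: "r \<longlonglongrightarrow> l \<Longrightarrow> Z_limsup r = l"
  unfolding Z_limsup_def by (rule Greatest_equality) (auto simp: Z_cluster_point_LIMSEQ_iff)

lemma Z_core_subset_of_null_diff:
  assumes null: "\<And>\<epsilon>. \<epsilon> > 0 \<Longrightarrow> {n. \<bar>y n - x n\<bar> \<ge> \<epsilon>} \<in> density_zero"
  shows "Z_core y \<subseteq> Z_core x"
proof
  fix \<eta> assume \<eta>: "\<eta> \<in> Z_core y"
  show "\<eta> \<in> Z_core x"
    unfolding Z_core_def
  proof
    fix S assume S: "S \<in> density_zero_star"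
    define C where "C = convex hull (x ` S)"
    show "\<eta> \<in> closure (convex hull (x ` S))"
      unfolding closure_approachable
    proof (intro allI impI)
      fix \<epsilon> :: real assume "\<epsilon> > 0"
      define T where "T = S \<inter> {n. \<bar>y n - x n\<bar> < \<epsilon> / 2}"
      \<comment> \<open>The closed \<epsilon>/2-thickening of \<open>C\<close>, written as a
        Minkowski sum so that its convexity is immediate. The other \<epsilon>/2 pays for
        approximating \<eta> by a point of \<open>D\<close>.\<close>
      define D where "D = (\<Union>u\<in>C. \<Union>v\<in>cball 0 (\<epsilon> / 2). {u + v})"
      have "- {n. \<bar>y n - x n\<bar> < \<epsilon> / 2} = {n. \<bar>y n - x n\<bar> \<ge> \<epsilon> / 2}"
        by auto
      then have "T \<in> density_zero_star"
        unfolding T_def using S null[of "\<epsilon> / 2"] \<open>\<epsilon> > 0\<close>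
        by (intro density_zero_star_Int) (auto simp: density_zero_star_def)
      then have "\<eta> \<in> closure (convex hull (y ` T))"
        using \<eta> by (auto simp: Z_core_def)
      moreover have "convex hull (y ` T) \<subseteq> D"
      proof (rule hull_minimal)
        show "y ` T \<subseteq> D"
        proof (rule image_subsetI)
          fix n assume "n \<in> T"
          then have "x n \<in> C" and "y n - x n \<in> cball 0 (\<epsilon> / 2)"
            by (auto simp: T_def C_def hull_inc)
          then show "y n \<in> D"
            unfolding D_def by force
        qed
        show "convex D"
          unfolding D_def C_def by (intro convex_sums convex_convex_hull convex_cball)
      qed
      ultimately have "\<eta> \<in> closure D"
        using closure_mono by blast
      then obtain d where "d \<in> D" "dist d \<eta> < \<epsilon> / 2"
        using \<open>\<epsilon> > 0\<close> unfolding closure_approachable by (meson half_gt_zero)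
      then obtain u v where "u \<in> C" "\<bar>v\<bar> \<le> \<epsilon> / 2" "dist (u + v) \<eta> < \<epsilon> / 2"
        by (auto simp: D_def)
      then show "\<exists>u\<in>convex hull (x ` S). dist u \<eta> < \<epsilon>"
        unfolding C_def by (intro bexI[of _ u]) (auto simp: dist_real_def abs_if split: if_splits)
    qed
  qed
qed

lemma Z_core_eq_of_null_diff:
  assumes "\<And>\<epsilon>. \<epsilon> > 0 \<Longrightarrow> {n. \<bar>y n - x n\<bar> \<ge> \<epsilon>} \<in> density_zero"
  shows "Z_core y = Z_core x"
  using Z_core_subset_of_null_diff[of y x] Z_core_subset_of_null_diff[of x y] assms
  by (auto simp: abs_minus_commute)

section \<open>Hadamard matrices\<close>

text \<open>The Sylvester (Walsh) matrix: the sign is -1 to the number of binary places where both n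
  and k have digit 1. One infinite table serves all orders, since its leading corner of size
  \<open>2 ^ j\<close> is the Hadamard matrix of that order.\<close>

fun hadamard :: "nat \<Rightarrow> nat \<Rightarrow> real" where
  "hadamard n k = (if n = 0 \<or> k = 0 then 1
     else (if odd n \<and> odd k then - 1 else 1) * hadamard (n div 2) (k div 2))"

declare hadamard.simps [simp del]

lemma abs_hadamard [simp]: "\<bar>hadamard n k\<bar> = 1"
  by (induction n k rule: hadamard.induct) (subst hadamard.simps, auto simp: abs_mult)

lemma hadamard_zero [simp]: "hadamard 0 k = 1" "hadamard n 0 = 1"
  by (simp_all add: hadamard.simps)

lemma hadamard_even_even [simp]: "hadamard (2 * n) (2 * k) = hadamard n k"
  by (cases "n = 0 \<or> k = 0") (auto simp: hadamard.simps[of "2 * n"])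

lemma hadamard_even_odd [simp]: "hadamard (2 * n) (Suc (2 * k)) = hadamard n k"
  by (cases "n = 0") (auto simp: hadamard.simps[of "2 * n"])

lemma hadamard_odd_even [simp]: "hadamard (Suc (2 * n)) (2 * k) = hadamard n k"
  by (cases "k = 0") (auto simp: hadamard.simps[of "Suc (2 * n)"])

lemma hadamard_odd_odd [simp]: "hadamard (Suc (2 * n)) (Suc (2 * k)) = - hadamard n k"
  by (simp add: hadamard.simps[of "Suc (2 * n)"])

lemma sum_lessThan_double:
  fixes f :: "nat \<Rightarrow> 'a::comm_monoid_add"
  shows "(\<Sum>k<2 * m. f k) = (\<Sum>k<m. f (2 * k) + f (Suc (2 * k)))"
  by (induction m) (auto simp: add.assoc)

text \<open>Splitting rows and columns by parity, as in the fast Walsh transform, rows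
  \<open>2 * n\<close> and \<open>2 * n + 1\<close> give \<open>u n + v n\<close> and
  \<open>u n - v n\<close>, where u and v are half-size transforms. The parallelogram law then
  yields the factor 2.\<close>

lemma hadamard_parseval:
  "(\<Sum>n<2 ^ j. (\<Sum>k<2 ^ j. hadamard n k * x k)\<^sup>2) = 2 ^ j * (\<Sum>k<2 ^ j. (x k)\<^sup>2)"
proof (induction j arbitrary: x)
  case 0
  show ?case by simp
next
  case (Suc j)
  define u where "u n = (\<Sum>k<2 ^ j. hadamard n k * x (2 * k))" for n
  define v where "v n = (\<Sum>k<2 ^ j. hadamard n k * x (Suc (2 * k)))" for n
  have even: "(\<Sum>k<2 * 2 ^ j. hadamard (2 * n) k * x k) = u n + v n" for n
    by (simp add: sum_lessThan_double u_def v_def sum.distrib)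
  have odd: "(\<Sum>k<2 * 2 ^ j. hadamard (Suc (2 * n)) k * x k) = u n - v n" for n
    by (simp add: sum_lessThan_double u_def v_def sum_subtractf)
  have "(\<Sum>n<2 ^ Suc j. (\<Sum>k<2 ^ Suc j. hadamard n k * x k)\<^sup>2)
      = (\<Sum>n<2 ^ j. (u n + v n)\<^sup>2 + (u n - v n)\<^sup>2)"
    unfolding power_Suc
    by (subst sum_lessThan_double) (simp only: even odd)
  also have "\<dots> = (\<Sum>n<2 ^ j. 2 * (u n)\<^sup>2 + 2 * (v n)\<^sup>2)"
    by (intro sum.cong) (auto simp: power2_eq_square algebra_simps)
  also have "\<dots> = 2 * (\<Sum>n<2 ^ j. (u n)\<^sup>2) + 2 * (\<Sum>n<2 ^ j. (v n)\<^sup>2)"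
    by (simp add: sum.distrib sum_distrib_left)
  also have "\<dots> = 2 ^ Suc j * (\<Sum>k<2 ^ Suc j. (x k)\<^sup>2)"
    using Suc.IH[of "\<lambda>k. x (2 * k)"] Suc.IH[of "\<lambda>k. x (Suc (2 * k))"]
    by (simp add: u_def v_def sum_lessThan_double sum.distrib algebra_simps)
  finally show ?case .
qed

section \<open>The perturbed identity matrix\<close>

text \<open>The order of the Hadamard matrix used in row n, constant on dyadic blocks. Row 0 lies in
  no such block; as \<open>floor_log 0 = 0\<close>, it gets order 2.\<close>

definition block :: "nat \<Rightarrow> nat" where
  "block n = 2 ^ Suc (floor_log n)"

definition perturb :: "(nat \<Rightarrow> real) \<Rightarrow> nat \<Rightarrow> real" where
  "perturb x n = (\<Sum>k<block n. hadamard n k * x k) / real (block n)"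

definition perturbed_identity :: "nat \<Rightarrow> nat \<Rightarrow> real" where
  "perturbed_identity n k =
     (if k = n then 1 else 0) + (if k < block n then hadamard n k / real (block n) else 0)"

lemma block_pos [simp]: "block n > 0"
  by (simp add: block_def)

lemma less_block: "n < block n"
  using floor_log_exp2_gt[of n] by (simp add: block_def)

lemma block_eq: "2 ^ j \<le> n \<Longrightarrow> n < 2 ^ Suc j \<Longrightarrow> block n = 2 ^ Suc j"
  using floor_log_eqI[of n j] order.strict_trans2[of 0 "2 ^ j" n] by (simp add: block_def)

text \<open>Each row has finite support: by \<open>less_block\<close> the diagonal entry already
  lies among the first \<open>block n\<close> columns. Hence no convergence question arises.\<close>

lemma perturbed_identity_sums:
  "(\<lambda>k. perturbed_identity n k * x k) sums (x n + perturb x n)"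
proof -
  have "(\<lambda>k. perturbed_identity n k * x k) sums (\<Sum>k<block n. perturbed_identity n k * x k)"
    using less_block[of n] by (intro sums_finite) (auto simp: perturbed_identity_def)
  also have "(\<Sum>k<block n. perturbed_identity n k * x k) =
      (\<Sum>k<block n. (if k = n then x k else 0) + hadamard n k * x k / real (block n))"
    by (intro sum.cong) (auto simp: perturbed_identity_def algebra_simps)
  also have "\<dots> = x n + perturb x n"
    using less_block[of n] by (simp add: sum.distrib perturb_def sum_divide_distrib)
  finally show ?thesis .
qed

lemma transform_perturbed_identity: "transform perturbed_identity x n = x n + perturb x n"
  unfolding transform_def by (rule sums_unique[symmetric]) (rule perturbed_identity_sums)

section \<open>Boundedness and the energy estimate\<close>

lemma abs_perturb_le:
  assumes "\<And>k. \<bar>x k\<bar> \<le> K"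
  shows "\<bar>perturb x n\<bar> \<le> K"
proof -
  have "\<bar>\<Sum>k<block n. hadamard n k * x k\<bar> \<le> (\<Sum>k<block n. \<bar>hadamard n k * x k\<bar>)"
    by (rule sum_abs)
  also have "\<dots> \<le> (\<Sum>k<block n. K)"
    using assms by (intro sum_mono) (simp add: abs_mult)
  finally show ?thesis
    by (simp add: perturb_def field_simps)
qed

lemma perturbed_identity_in_ell_infty_matrices: "perturbed_identity \<in> ell_infty_matrices"
  unfolding ell_infty_matrices_def
proof (intro CollectI ballI conjI)
  fix x assume "x \<in> ell_infty"
  then obtain K where K: "\<And>k. \<bar>x k\<bar> \<le> K"
    by (auto simp: ell_infty_def bounded_iff)
  show "transform_defined perturbed_identity x"
    unfolding transform_defined_def using perturbed_identity_sums sums_summable by blast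
  have "\<bar>transform perturbed_identity x n\<bar> \<le> K + K" for n
    using K[of n] abs_perturb_le[of x K n, OF K] by (simp add: transform_perturbed_identity)
  then show "transform perturbed_identity x \<in> ell_infty"
    by (auto simp: ell_infty_def bounded_iff)
qed

text \<open>The rows of a dyadic block are the lower half of one Hadamard matrix of order M.
  Parseval over all M rows gives a factor M against the normalisation \<open>M^2\<close>, leaving a
  mean of squares, with a bound independent of j.\<close>

lemma sum_perturb_block_le:
  assumes "\<And>k. \<bar>x k\<bar> \<le> K"
  shows "(\<Sum>n = 2 ^ j..<2 ^ Suc j. (perturb x n)\<^sup>2) \<le> K\<^sup>2"
proof -
  define M :: nat where "M = 2 ^ Suc j"
  have "M > 0" by (simp add: M_def)
  have "(\<Sum>n = 2 ^ j..<2 ^ Suc j. (perturb x n)\<^sup>2)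
      = (\<Sum>n = 2 ^ j..<M. (\<Sum>k<M. hadamard n k * x k)\<^sup>2) / (real M)\<^sup>2"
    unfolding sum_divide_distrib[where r = "(real M)\<^sup>2"]
    by (intro sum.cong) (auto simp: perturb_def block_eq M_def power_divide)
  also have "\<dots> \<le> (\<Sum>n<M. (\<Sum>k<M. hadamard n k * x k)\<^sup>2) / (real M)\<^sup>2"
    by (intro divide_right_mono sum_mono2) auto
  also have "\<dots> = (\<Sum>k<M. (x k)\<^sup>2) / real M"
    using \<open>M > 0\<close> unfolding M_def hadamard_parseval by (simp add: power2_eq_square)
  also have "\<dots> \<le> (\<Sum>k<M. K\<^sup>2) / real M"
    \<comment> \<open>The second fact is \<open>0 \<le> K\<close>, needed to square the
      bound.\<close>
    using assms order.trans[OF abs_ge_zero assms]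
    by (intro divide_right_mono sum_mono) (auto simp: power2_le_iff_abs_le)
  also have "\<dots> = K\<^sup>2"
    using \<open>M > 0\<close> by simp
  finally show ?thesis .
qed

text \<open>Row 0 and each of the j dyadic blocks below \<open>2 ^ j\<close> contribute at most
  \<open>K\<^sup>2\<close>.\<close>

lemma sum_perturb_le:
  assumes "\<And>k. \<bar>x k\<bar> \<le> K"
  shows "(\<Sum>n<2 ^ j. (perturb x n)\<^sup>2) \<le> (real j + 1) * K\<^sup>2"
proof (induction j)
  case 0
  have "\<bar>perturb x 0\<bar> \<le> \<bar>K\<bar>"
    using abs_perturb_le[of x K 0, OF assms] by linarith
  then show ?case
    by (simp add: abs_le_square_iff)
next
  case (Suc j)
  have "{..<2 ^ Suc j} = {..<2 ^ j} \<union> {2 ^ j..<2 ^ Suc j :: nat}"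
    by auto
  then have "(\<Sum>n<2 ^ Suc j. (perturb x n)\<^sup>2)
      = (\<Sum>n<2 ^ j. (perturb x n)\<^sup>2) + (\<Sum>n = 2 ^ j..<2 ^ Suc j. (perturb x n)\<^sup>2)"
    by (metis finite_atLeastLessThan finite_lessThan ivl_disj_int_one(2) sum.union_disjoint)
  then show ?case
    using Suc.IH sum_perturb_block_le[of x K j, OF assms] by (simp add: algebra_simps)
qed

text \<open>A Chebyshev argument: each index of the set costs at least the square of \<epsilon>,
  while the energy up to n is only O(log n).\<close>

lemma perturb_null:
  assumes K: "\<And>k. \<bar>x k\<bar> \<le> K" and "\<epsilon> > 0"
  shows "{n. \<bar>perturb x n\<bar> \<ge> \<epsilon>} \<in> density_zero"
proof -
  define S where "S = {n. \<bar>perturb x n\<bar> \<ge> \<epsilon>}"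
  have "real (card (S \<inter> {0..n})) \<le> (log 2 (real n) + 2) * K\<^sup>2 / \<epsilon>\<^sup>2" if "n > 0" for n
  proof -
    have "real (card (S \<inter> {0..n})) * \<epsilon>\<^sup>2 = (\<Sum>m\<in>S \<inter> {0..n}. \<epsilon>\<^sup>2)"
      by simp
    also have "\<dots> \<le> (\<Sum>m\<in>S \<inter> {0..n}. (perturb x m)\<^sup>2)"
      using \<open>\<epsilon> > 0\<close> by (intro sum_mono) (auto simp: S_def abs_le_square_iff[symmetric])
    \<comment> \<open>The range is enlarged to the next power of two, so
      \<open>sum_perturb_le\<close> applies with j = \<open>Suc (floor_log n)\<close>; this is the
      source of the summand 2 beside the logarithm.\<close>
    also have "\<dots> \<le> (\<Sum>m<2 ^ Suc (floor_log n). (perturb x m)\<^sup>2)"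
      using less_block[of n] unfolding block_def by (intro sum_mono2) auto
    also have "\<dots> \<le> (real (Suc (floor_log n)) + 1) * K\<^sup>2"
      by (rule sum_perturb_le[OF K])
    also have "\<dots> \<le> (log 2 (real n) + 2) * K\<^sup>2"
    proof (rule mult_right_mono)
      have "real (2 ^ floor_log n) \<le> real n"
        using floor_log_exp2_le[OF that] of_nat_mono by blast
      then have "real (floor_log n) \<le> log 2 (real n)"
        using that by (simp add: le_log_iff powr_realpow)
      then show "real (Suc (floor_log n)) + 1 \<le> log 2 (real n) + 2"
        by simp
    qed simp
    finally show ?thesis
      using \<open>\<epsilon> > 0\<close> by (simp add: field_simps)
  qed
  then have "(\<lambda>n. real (card (S \<inter> {0..n}))) \<in> O(\<lambda>n. (log 2 (real n) + 2) * K\<^sup>2 / \<epsilon>\<^sup>2)"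
    by (intro landau_o.big_mono eventually_mono[OF eventually_gt_at_top[of 0]])
      (auto intro: order.trans[OF _ abs_ge_self])
  also have "(\<lambda>n. (log 2 (real n) + 2) * K\<^sup>2 / \<epsilon>\<^sup>2) \<in> o(\<lambda>n. real n)"
  proof -
    have "(\<lambda>n. log 2 (real n) + 2) \<in> o(\<lambda>n. real n)"
      by real_asymp
    then show ?thesis
      \<comment> \<open>A constant factor can be cancelled only if nonzero; for \<open>K = 0\<close>
        the function vanishes.\<close>
      using \<open>\<epsilon> > 0\<close> by (cases "K = 0") auto
  qed
  finally show ?thesis
    by (simp add: density_zero_def S_def)
qed

section \<open>Core equality and row norms\<close>

lemma Z_core_transform_perturbed_identity:
  assumes "x \<in> ell_infty"
  shows "Z_core (transform perturbed_identity x) = Z_core x"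
proof -
  obtain K where "\<And>k. \<bar>x k\<bar> \<le> K"
    using assms by (auto simp: ell_infty_def bounded_iff)
  then show ?thesis
    by (intro Z_core_eq_of_null_diff) (auto simp: transform_perturbed_identity intro: perturb_null)
qed

lemma infsum_abs_perturbed_identity:
  "(\<Sum>\<^sub>\<infinity>k. \<bar>perturbed_identity n k\<bar>) = 2 + (hadamard n n - 1) / real (block n)"
proof -
  have "hadamard n n / real (block n) \<ge> - 1"
    using abs_hadamard[of n n] less_block[of n]
    by (simp add: field_simps abs_if Suc_le_eq split: if_splits)
  then have diag: "\<bar>perturbed_identity n n\<bar> = 1 + hadamard n n / real (block n)"
    using less_block[of n] by (simp add: perturbed_identity_def)
  have "(\<Sum>\<^sub>\<infinity>k. \<bar>perturbed_identity n k\<bar>) = (\<Sum>\<^sub>\<infinity>k\<in>{..<block n}. \<bar>perturbed_identity n k\<bar>)"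
    using less_block[of n] by (intro infsum_cong_neutral) (auto simp: perturbed_identity_def)
  also have "\<dots> = \<bar>perturbed_identity n n\<bar> + (\<Sum>k\<in>{..<block n} - {n}. \<bar>perturbed_identity n k\<bar>)"
    using less_block[of n] by (simp add: sum.remove)
  also have "(\<Sum>k\<in>{..<block n} - {n}. \<bar>perturbed_identity n k\<bar>)
      = (\<Sum>k\<in>{..<block n} - {n}. 1 / real (block n))"
    by (intro sum.cong) (auto simp: perturbed_identity_def)
  \<comment> \<open>There are \<open>block n - 1\<close> off-diagonal entries in the
    support.\<close>
  also have "\<dots> = 1 - 1 / real (block n)"
    using less_block[of n] by (simp add: of_nat_diff field_simps)
  finally show ?thesis
    by (simp add: diag diff_divide_distrib)
qed

lemma LIMSEQ_infsum_abs_perturbed_identity: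
  "(\<lambda>n. \<Sum>\<^sub>\<infinity>k. \<bar>perturbed_identity n k\<bar>) \<longlonglongrightarrow> 2"
proof -
  have "(\<lambda>n. (hadamard n n - 1) / real (block n)) \<longlonglongrightarrow> 0"
  proof (rule Lim_null_comparison)
    show "(\<lambda>n. 2 / real n) \<longlonglongrightarrow> 0"
      by real_asymp
    show "\<forall>\<^sub>F n in sequentially. norm ((hadamard n n - 1) / real (block n)) \<le> 2 / real n"
      using eventually_gt_at_top[of 0]
    proof eventually_elim
      case (elim n)
      have "\<bar>hadamard n n - 1\<bar> \<le> 2"
        using abs_triangle_ineq4[of "hadamard n n" 1] by simp
      then show ?case
        using less_block[of n] elim by (simp add: frac_le)
    qed
  qed
  from tendsto_add[OF tendsto_const[of 2] this] show ?thesis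
    by (simp add: infsum_abs_perturbed_identity)
qed

theorem mainTheorem2:
  shows "\<exists>B :: nat \<Rightarrow> nat \<Rightarrow> real. B \<in> ell_infty_matrices \<and>
           (\<forall>x\<in>ell_infty. Z_core (transform B x) = Z_core x) \<and>
           \<not> (\<forall>E :: nat set. E \<notin> density_zero \<longrightarrow>
                 Z_limsup (\<lambda>n. \<Sum>\<^sub>\<infinity>k\<in>E. \<bar>B n k\<bar>) = 1)"
proof (intro exI[of _ perturbed_identity] conjI ballI notI)
  assume "\<forall>E. E \<notin> density_zero \<longrightarrow> Z_limsup (\<lambda>n. \<Sum>\<^sub>\<infinity>k\<in>E. \<bar>perturbed_identity n k\<bar>) = 1"
  then have "Z_limsup (\<lambda>n. \<Sum>\<^sub>\<infinity>k. \<bar>perturbed_identity n k\<bar>) = 1"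
    \<comment> \<open>Taking \<open>E = UNIV\<close> turns the sums into full row norms, whose limit
      is 2.\<close>
    using UNIV_notin_density_zero by blast
  then show False
    by (simp add: Z_limsup_LIMSEQ[OF LIMSEQ_infsum_abs_perturbed_identity])
qed (use perturbed_identity_in_ell_infty_matrices Z_core_transform_perturbed_identity in auto)

end
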